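(* Let $n\ge2$, let $q$ be a prime power and $\mathbb{V}_0=\mathbb{F}_q^n$. The graph $\mathbf{SIG}(\mathbb{V}_0)$ is a connected graph with $\frac{q^n-1}{(q-1)^2}\,(q^{n^2-n+1}-1)$ edges and $\mathrm{diam}(\mathbf{SIG}(\mathbb{V}_0))=4$.
   Context: $\mathbb{F}_q$ is the finite field with $q$ elements and $\mathbb{V}_0=\mathbb{F}_q^n$ is the space of column vectors. $E_n(\mathbb{F}_q)$ is the set of nonzero matrices $M\in M_n(\mathbb{F}_q)$ having at least one eigenvector in $\mathbb{V}_0$ (a nonzero $v$ with $Mv=\lambda v$ for some $\lambda\in\mathbb{F}_q$; $\lambda=0$ allowed). $\mathcal{E}^{n-1}(\mathbb{F}_q)=\{\langle M\rangle: M\in E_n(\mathbb{F}_q)\}$ is the set of one-dimensional subspaces of $M_n(\mathbb{F}_q)$ generated by elements of $E_n(\mathbb{F}_q)$, and $\mathbb{P}^{n-1}(\mathbb{F}_q)$ is the set of one-dimensional subspaces $\langle v\rangle$ of $\mathbb{V}_0$. The spectral incidence graph $\mathbf{SIG}(\mathbb{V}_0)$ is the simple bipartite graph with vertex set the disjoint union $\mathcal{E}^{n-1}(\mathbb{F}_q)\cup\mathbb{P}^{n-1}(\mathbb{F}_q)$ in which $\langle M\rangle$ and $\langle v\rangle$ are adjacent iff $v$ is an eigenvector of $M$. *)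

theory Defs
  imports
    "Jordan_Normal_Form.Char_Poly"
    "Jordan_Normal_Form.VS_Connect"
    "Graph_Theory.Graph_Theory"
    "HOL-Number_Theory.Prime_Powers"
    "HOL-Library.Cardinality"
begin

section \<open>Edges and diameter of a graph\<close>

text \<open>Following \<^locale>\<open>graph\<close>, an undirected graph is a symmetric digraph; an undirected edge
  is then a pair of opposite arcs, represented here by its set of end points.\<close>

definition uedges :: "('v, 'e) pre_digraph \<Rightarrow> 'v set set" where
  "uedges G = (\<lambda>e. {tail G e, head G e}) ` arcs G"

text \<open>With unit weights, the weighted distance is the least number of edges of a walk
  (\<^term>\<open>\<infinity>::ereal\<close> if there is none), for every well-formed digraph.\<close>

definition graph_dist :: "('v, 'e) pre_digraph \<Rightarrow> 'v \<Rightarrow> 'v \<Rightarrow> ereal" where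
  "graph_dist G u v = wf_digraph.\<mu> G (\<lambda>_. 1) u v"

definition diam :: "('v, 'e) pre_digraph \<Rightarrow> ereal" where
  "diam G = (SUP (u, v) \<in> verts G \<times> verts G. graph_dist G u v)"


section \<open>The spectral incidence graph\<close>

definition vec_line :: "nat \<Rightarrow> 'a :: field vec \<Rightarrow> 'a vec set" where
  "vec_line n v = LinearCombinations.module.span class_ring (module_vec TYPE('a) n) {v}"

definition mat_line :: "nat \<Rightarrow> 'a :: field mat \<Rightarrow> 'a mat set" where
  "mat_line n M = LinearCombinations.module.span class_ring (module_mat TYPE('a) n n) {M}"

definition mats_with_eigenvector :: "'a :: field itself \<Rightarrow> nat \<Rightarrow> 'a mat set" where
  "mats_with_eigenvector _ n =
     {M \<in> carrier_mat n n. M \<noteq> 0\<^sub>m n n \<and> (\<exists>v k. eigenvector M v k)}"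

definition mat_points :: "'a :: field itself \<Rightarrow> nat \<Rightarrow> 'a mat set set" where
  "mat_points ty n = mat_line n ` mats_with_eigenvector ty n"

definition vec_points :: "'a :: field itself \<Rightarrow> nat \<Rightarrow> 'a vec set set" where
  "vec_points _ n = vec_line n ` {v \<in> carrier_vec n. v \<noteq> 0\<^sub>v n}"

definition sig_incidence :: "'a :: field itself \<Rightarrow> nat \<Rightarrow> ('a mat set \<times> 'a vec set) set" where
  "sig_incidence ty n =
     {(mat_line n M, vec_line n v) | M v.
        M \<in> mats_with_eigenvector ty n \<and> (\<exists>k. eigenvector M v k)}"

definition SIG :: "'a :: field itself \<Rightarrow> nat \<Rightarrow>
    ('a mat set + 'a vec set, ('a mat set + 'a vec set) \<times> ('a mat set + 'a vec set)) pre_digraph" where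
  "SIG ty n =
     \<lparr> verts = mat_points ty n <+> vec_points ty n,
       arcs = {(Inl L, Inr l) | L l. (L, l) \<in> sig_incidence ty n} \<union>
              {(Inr l, Inl L) | L l. (L, l) \<in> sig_incidence ty n},
       tail = fst, head = snd \<rparr>"


section \<open>Elementary properties\<close>

lemma vec_line_eq:
  assumes "v \<in> carrier_vec n"
  shows "vec_line n (v :: 'a :: field vec) = {c \<cdot>\<^sub>v v | c. True}"
proof -
  interpret vec_space "TYPE('a)" n .
  have "lincomb a {v} = a v \<cdot>\<^sub>v v" for a
    using assms by (simp add: lincomb_def module_vec_simps)
  moreover have "\<exists>a :: 'a vec \<Rightarrow> 'a. c = a v" for c
    by (rule exI[of _ "\<lambda>_. c"]) simp
  ultimately show ?thesis
    unfolding vec_line_def using finite_span[of "{v}"] assms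
    by auto
qed

lemma mat_line_eq:
  assumes "M \<in> carrier_mat n n"
  shows "mat_line n (M :: 'a :: field mat) = {c \<cdot>\<^sub>m M | c. True}"
proof -
  interpret matrix_vs n n "TYPE('a)" .
  have "lincomb a {M} = a M \<cdot>\<^sub>m M" for a
    using assms by (simp add: lincomb_def)
  moreover have "\<exists>a :: 'a mat \<Rightarrow> 'a. c = a M" for c
    by (rule exI[of _ "\<lambda>_. c"]) simp
  ultimately show ?thesis
    unfolding mat_line_def using finite_span[of "{M}"] assms
    by auto
qed

lemma line_eq_imp_vec:
  assumes "v \<in> carrier_vec n" "w \<in> carrier_vec n" "w \<noteq> 0\<^sub>v n" "vec_line n v = vec_line n (w :: 'a :: field vec)"
  obtains c where "c \<noteq> 0" "w = c \<cdot>\<^sub>v v"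
proof -
  have "w \<in> vec_line n w"
    using assms(2) by (auto simp: vec_line_eq intro!: exI[of _ 1])
  then obtain c where "w = c \<cdot>\<^sub>v v"
    using assms(1,4) by (auto simp: vec_line_eq)
  moreover have "c \<noteq> 0"
    using assms(1,3) \<open>w = c \<cdot>\<^sub>v v\<close> by auto
  ultimately show ?thesis using that by blast
qed

lemma line_eq_imp_mat:
  assumes "M \<in> carrier_mat n n" "N \<in> carrier_mat n n" "N \<noteq> 0\<^sub>m n n" "mat_line n M = mat_line n (N :: 'a :: field mat)"
  obtains c where "c \<noteq> 0" "N = c \<cdot>\<^sub>m M"
proof -
  have "N = 1 \<cdot>\<^sub>m N" by (intro eq_matI) auto
  then have "N \<in> mat_line n N"
    using assms(2) by (auto simp: mat_line_eq)
  then obtain c where c: "N = c \<cdot>\<^sub>m M"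
    using assms(1,4) by (auto simp: mat_line_eq)
  moreover have "c \<noteq> 0"
  proof
    assume "c = 0"
    then have "N = 0\<^sub>m n n" using c assms(1) by (intro eq_matI) auto
    then show False using assms(3) by simp
  qed
  ultimately show ?thesis using that by blast
qed

lemma eigenvector_smult:
  assumes "M \<in> carrier_mat n n" "eigenvector (M :: 'a :: field mat) v k" "c \<noteq> 0" "d \<noteq> 0"
  shows "eigenvector (c \<cdot>\<^sub>m M) (d \<cdot>\<^sub>v v) (c * k)"
proof -
  have v: "v \<in> carrier_vec n" "v \<noteq> 0\<^sub>v n" "M *\<^sub>v v = k \<cdot>\<^sub>v v"
    using assms by (auto simp: eigenvector_def)
  have "d \<cdot>\<^sub>v v \<noteq> 0\<^sub>v n"
  proof
    assume "d \<cdot>\<^sub>v v = 0\<^sub>v n"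
    then have "inverse d \<cdot>\<^sub>v (d \<cdot>\<^sub>v v) = 0\<^sub>v n" by auto
    then show False using v assms(4) by (simp add: smult_smult_assoc)
  qed
  moreover have "(c \<cdot>\<^sub>m M) *\<^sub>v (d \<cdot>\<^sub>v v) = c \<cdot>\<^sub>v (d \<cdot>\<^sub>v (M *\<^sub>v v))"
    using v(1) assms(1) by (intro eq_vecI) (auto simp: scalar_prod_def sum_distrib_left mult_ac)
  ultimately show ?thesis
    using v assms(1) by (auto simp: eigenvector_def smult_smult_assoc mult_ac)
qed

text \<open>Adjacency does not depend on the chosen generators.\<close>

lemma sig_incidence_iff:
  assumes M: "M \<in> mats_with_eigenvector TYPE('a :: field) n"
    and v: "v \<in> carrier_vec n" "v \<noteq> 0\<^sub>v n"
  shows "(mat_line n M, vec_line n v) \<in> sig_incidence TYPE('a) n \<longleftrightarrow> (\<exists>k. eigenvector M v k)"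
proof
  assume "(mat_line n M, vec_line n v) \<in> sig_incidence TYPE('a) n"
  then obtain N w k where N: "N \<in> mats_with_eigenvector TYPE('a) n" "eigenvector N w k"
    and eq: "mat_line n M = mat_line n N" "vec_line n v = vec_line n w"
    by (auto simp: sig_incidence_def)
  have Nc: "N \<in> carrier_mat n n" and Mc: "M \<in> carrier_mat n n" "M \<noteq> 0\<^sub>m n n"
    using N M by (auto simp: mats_with_eigenvector_def)
  have "w \<in> carrier_vec n" using N(2) Nc by (auto simp: eigenvector_def)
  from line_eq_imp_vec[OF this v eq(2)[symmetric]] obtain d where d: "d \<noteq> 0" "v = d \<cdot>\<^sub>v w" .
  from line_eq_imp_mat[OF Nc Mc eq(1)[symmetric]] obtain c where c: "c \<noteq> 0" "M = c \<cdot>\<^sub>m N" .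
  show "\<exists>k. eigenvector M v k"
    using eigenvector_smult[OF Nc N(2) c(1) d(1)] c d by auto
qed (use M in \<open>auto simp: sig_incidence_def\<close>)

lemma wf_digraph_SIG: "wf_digraph (SIG TYPE('a :: field) n)"
proof -
  have "L \<in> mat_points TYPE('a) n \<and> l \<in> vec_points TYPE('a) n"
    if "(L, l) \<in> sig_incidence TYPE('a) n" for L l
    using that by (auto simp: sig_incidence_def mat_points_def vec_points_def
        mats_with_eigenvector_def eigenvector_def)
  then show ?thesis by unfold_locales (auto simp: SIG_def)
qed

end

theory Submission
  imports Defs "Berlekamp_Zassenhaus.Berlekamp_Type_Based"
begin

text \<open>
  The diameter and the connectedness come from one special vertex, the line of the identity
  matrix. Every nonzero vector is an eigenvector of the identity, so this vertex is adjacent to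
  all points of the projective space; and every matrix vertex is adjacent to some point, because
  its matrix has an eigenvector. Hence every vertex has distance at most 2 from the line of the
  identity (\<open>walks_via_one_mat\<close>), the graph is connected and its diameter is at most 4.
  Two matrix vertices at distance less than 4 have a common neighbour, since the graph is
  bipartite; that is, their matrices have a common eigenvector. The nilpotent shift matrix and
  its transpose have eigenvectors but no common one (\<open>no_common_eigenvector_shift_mat\<close>),
  and so the bound 4 is attained.

  The edges correspond to the incident pairs of a matrix line and a vector line. They are counted
  through their generators, the pairs of a nonzero matrix \<open>M\<close> and an eigenvector \<open>v\<close> of \<open>M\<close>:
  each incidence has \<open>(q - 1)\<^sup>2\<close> such pairs of generators (\<open>card_eigenpair_fibre\<close>). For a fixed
  \<open>v \<noteq> 0\<close> the linear map \<open>M \<mapsto> M v\<close> is onto, so its fibres all have the same size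
  \<open>q^(n\<^sup>2 - n)\<close> (\<open>card_mats_sending_vec\<close>), and \<open>v\<close> is an eigenvector of \<open>M\<close> exactly if \<open>M v\<close>
  is one of the \<open>q\<close> multiples of \<open>v\<close>. This gives \<open>q^(n\<^sup>2 - n + 1) - 1\<close> nonzero matrices for each
  of the \<open>q^n - 1\<close> vectors.
\<close>

section \<open>Counting matrices over a finite field\<close>

lemma nonzero_vec_entry:
  assumes "v \<in> carrier_vec n" "v \<noteq> 0\<^sub>v n"
  obtains i where "i < n" "v $ i \<noteq> 0"
  using assms by (metis carrier_vecD eq_vecI index_zero_vec)

lemma nonzero_mat_entry:
  assumes "M \<in> carrier_mat m n" "M \<noteq> 0\<^sub>m m n"
  obtains i j where "i < m" "j < n" "M $$ (i, j) \<noteq> 0"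
proof (rule ccontr)
  assume "\<not> thesis"
  then have "M $$ (i, j) = 0" if "i < m" "j < n" for i j
    using that \<open>\<And>j i. i < m \<Longrightarrow> j < n \<Longrightarrow> M $$ (i, j) \<noteq> 0 \<Longrightarrow> thesis\<close> by blast
  then have "M = 0\<^sub>m m n" using assms(1) by (intro eq_matI) auto
  then show False using assms(2) by simp
qed

lemma smult_vec_cancel:
  assumes "v \<in> carrier_vec n" "v \<noteq> 0\<^sub>v n" "c \<cdot>\<^sub>v v = d \<cdot>\<^sub>v (v :: 'a :: field vec)"
  shows "c = d"
proof -
  obtain i where i: "i < n" "v $ i \<noteq> 0"
    using nonzero_vec_entry[OF assms(1,2)] .
  have "(c \<cdot>\<^sub>v v) $ i = (d \<cdot>\<^sub>v v) $ i" using assms(3) by simp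
  with i assms(1) show ?thesis by simp
qed

lemma smult_mat_cancel:
  assumes "M \<in> carrier_mat m n" "M \<noteq> 0\<^sub>m m n" "c \<cdot>\<^sub>m M = d \<cdot>\<^sub>m (M :: 'a :: field mat)"
  shows "c = d"
proof -
  obtain i j where i: "i < m" "j < n" "M $$ (i, j) \<noteq> 0"
    using nonzero_mat_entry[OF assms(1,2)] .
  have "(c \<cdot>\<^sub>m M) $$ (i, j) = (d \<cdot>\<^sub>m M) $$ (i, j)" using assms(3) by simp
  with i assms(1) show ?thesis by simp
qed

lemma bij_betw_mat:
  "bij_betw (mat m n) ({..<m} \<times> {..<n} \<rightarrow>\<^sub>E UNIV) (carrier_mat m n)"
  by (rule bij_betw_byWitness[where f' = "\<lambda>M. restrict (\<lambda>ij. M $$ ij) ({..<m} \<times> {..<n})"])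
    (auto simp: PiE_def extensional_def restrict_def fun_eq_iff)

lemma card_carrier_mat:
  "card (carrier_mat m n :: 'a :: finite mat set) = CARD('a) ^ (m * n)"
  using bij_betw_same_card[OF bij_betw_mat[where 'a = 'a, of m n]]
  by (simp add: card_PiE card_cartesian_product)

lemma finite_carrier_mat: "finite (carrier_mat m n :: 'a :: finite mat set)"
  using bij_betw_finite[OF bij_betw_mat[where 'a = 'a, of m n]]
  by (simp add: finite_PiE)

text \<open>Surjectivity of \<open>A \<mapsto> A v\<close>: if \<open>v $ j \<noteq> 0\<close>, the matrix whose only nonzero column is the
  \<open>j\<close>-th one, equal to \<open>w / v $ j\<close>, sends \<open>v\<close> to \<open>w\<close>.\<close>

lemma ex_mat_sending_vec:
  assumes v: "v \<in> carrier_vec n" "v \<noteq> 0\<^sub>v n" and w: "w \<in> carrier_vec m"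
  shows "\<exists>A \<in> carrier_mat m n. A *\<^sub>v v = (w :: 'a :: field vec)"
proof -
  obtain j where j: "j < n" "v $ j \<noteq> 0"
    using nonzero_vec_entry[OF v] .
  define A where "A = mat m n (\<lambda>(i, l). if l = j then w $ i / v $ j else 0)"
  have "A *\<^sub>v v = w"
  proof (rule eq_vecI)
    fix i assume "i < dim_vec w"
    then have i: "i < m" using w by simp
    have "(A *\<^sub>v v) $ i = (\<Sum>l = 0..<n. (if l = j then w $ i / v $ j else 0) * v $ l)"
      using i v(1) by (simp add: A_def scalar_prod_def)
    also have "\<dots> = (\<Sum>l = 0..<n. if l = j then w $ i / v $ j * v $ l else 0)"
      by (rule sum.cong) auto
    also have "\<dots> = w $ i" using j by simp
    finally show "(A *\<^sub>v v) $ i = w $ i" .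
  qed (use w in \<open>auto simp: A_def\<close>)
  then show ?thesis by (auto simp: A_def)
qed

text \<open>All fibres of \<open>M \<mapsto> M v\<close> are translates of the fibre over 0, so the \<open>q^m\<close> fibres divide
  the \<open>q^(m * n)\<close> matrices into parts of equal size.\<close>

lemma card_mats_sending_vec:
  assumes v: "v \<in> carrier_vec n" "v \<noteq> 0\<^sub>v n" and w: "w \<in> carrier_vec m"
  shows "card {M \<in> carrier_mat m n. M *\<^sub>v v = (w :: 'a :: {finite, field} vec)} * CARD('a) ^ m
    = CARD('a) ^ (m * n)"
proof -
  define F :: "'a vec \<Rightarrow> 'a mat set" where "F u = {M \<in> carrier_mat m n. M *\<^sub>v v = u}" for u
  have translate: "card (F u) = card (F (0\<^sub>v m))" if u: "u \<in> carrier_vec m" for u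
  proof -
    obtain A where A: "A \<in> carrier_mat m n" "A *\<^sub>v v = u"
      using ex_mat_sending_vec[OF v u] by blast
    have "bij_betw (\<lambda>M. M + A) (F (0\<^sub>v m)) (F u)"
    proof (rule bij_betw_byWitness[where f' = "\<lambda>M. M - A"])
      show "\<forall>M \<in> F (0\<^sub>v m). M + A - A = M"
        using A(1) by (auto simp: F_def intro!: eq_matI)
      show "\<forall>M \<in> F u. M - A + A = M"
        using A(1) by (auto simp: F_def intro!: eq_matI)
      show "(\<lambda>M. M + A) ` F (0\<^sub>v m) \<subseteq> F u"
        using A v(1) u by (auto simp: F_def add_mult_distrib_mat_vec)
      show "(\<lambda>M. M - A) ` F u \<subseteq> F (0\<^sub>v m)"
        using A v(1) u by (auto simp: F_def minus_mult_distrib_mat_vec)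
    qed
    then show ?thesis by (simp add: bij_betw_same_card)
  qed
  have "CARD('a) ^ (m * n) = (\<Sum>M \<in> (carrier_mat m n :: 'a mat set). 1)"
    by (simp add: card_carrier_mat)
  also have "\<dots> = (\<Sum>u \<in> carrier_vec m. card (F u))"
    unfolding F_def card_eq_sum using v(1)
    by (intro sum.group[symmetric] finite_carrier_mat finite_carrier_vec) auto
  also have "\<dots> = (\<Sum>u \<in> (carrier_vec m :: 'a vec set). card (F w))"
    by (intro sum.cong refl) (metis translate w)
  finally show ?thesis by (simp add: card_carrier_vec F_def mult.commute)
qed

text \<open>These matrices form the union of the fibres of \<open>M \<mapsto> M v\<close> over the \<open>q\<close> multiples of \<open>v\<close>.
  The zero
  matrix is among them, over the multiple 0.\<close>

lemma card_mats_with_given_eigenvector: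
  assumes v: "(v :: 'a :: {finite, field} vec) \<in> carrier_vec n" "v \<noteq> 0\<^sub>v n"
  shows "card {M \<in> carrier_mat n n. \<exists>k. eigenvector M v k} = CARD('a) ^ (n\<^sup>2 - n + 1)"
proof -
  let ?E = "{M \<in> carrier_mat n n. \<exists>k. eigenvector M v k}"
  let ?l = "(\<lambda>k. k \<cdot>\<^sub>v v) ` UNIV"
  have "n \<le> n * n" by simp
  then have "CARD('a) ^ (n * n) = CARD('a) ^ (n\<^sup>2 - n) * CARD('a) ^ n"
    by (simp add: power2_eq_square flip: power_add)
  then have fibre: "card {M \<in> carrier_mat n n. M *\<^sub>v v = w} = CARD('a) ^ (n\<^sup>2 - n)"
    if "w \<in> carrier_vec n" for w
    using card_mats_sending_vec[OF v that] by simp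
  have "card ?E = (\<Sum>M \<in> ?E. 1)" by simp
  also have "\<dots> = (\<Sum>w \<in> ?l. \<Sum>M \<in> {M \<in> ?E. M *\<^sub>v v = w}. 1)"
    by (intro sum.group[symmetric])
      (auto simp: eigenvector_def intro: finite_subset[OF _ finite_carrier_mat[of n n]])
  also have "\<dots> = (\<Sum>w \<in> ?l. CARD('a) ^ (n\<^sup>2 - n))"
  proof (rule sum.cong)
    fix w assume "w \<in> ?l"
    then have "w \<in> carrier_vec n" "{M \<in> ?E. M *\<^sub>v v = w} = {M \<in> carrier_mat n n. M *\<^sub>v v = w}"
      using v by (auto simp: eigenvector_def)
    then show "(\<Sum>M \<in> {M \<in> ?E. M *\<^sub>v v = w}. 1) = CARD('a) ^ (n\<^sup>2 - n)"
      using fibre by simp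
  qed simp
  also have "\<dots> = CARD('a) * CARD('a) ^ (n\<^sup>2 - n)"
    using smult_vec_cancel[OF v] by (simp add: card_image inj_on_def)
  finally show ?thesis by simp
qed


section \<open>Counting incidences\<close>

text \<open>The pairs of generators of the incidences, over which the double count runs.\<close>

definition eigenpairs :: "'a :: field itself \<Rightarrow> nat \<Rightarrow> ('a mat \<times> 'a vec) set" where
  "eigenpairs ty n = {(M, v). M \<in> mats_with_eigenvector ty n \<and> (\<exists>k. eigenvector M v k)}"

lemma eigenpairs_iff:
  "(M, v) \<in> eigenpairs TYPE('a :: field) n
    \<longleftrightarrow> M \<in> carrier_mat n n \<and> M \<noteq> 0\<^sub>m n n \<and> (\<exists>k. eigenvector M v k)"
  unfolding eigenpairs_def mats_with_eigenvector_def by blast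

lemma eigenpairsD:
  assumes "(M, v) \<in> eigenpairs TYPE('a :: field) n"
  shows "M \<in> carrier_mat n n" "M \<noteq> 0\<^sub>m n n" "v \<in> carrier_vec n" "v \<noteq> 0\<^sub>v n"
  using assms by (auto simp: eigenpairs_iff eigenvector_def)

lemma finite_eigenpairs: "finite (eigenpairs TYPE('a :: {finite, field}) n)"
  by (rule finite_subset[where B = "carrier_mat n n \<times> carrier_vec n"])
    (auto simp: finite_carrier_mat dest: eigenpairsD)

lemma card_eigenpairs:
  "card (eigenpairs TYPE('a :: {finite, field}) n)
    = (CARD('a) ^ n - 1) * (CARD('a) ^ (n\<^sup>2 - n + 1) - 1)"
proof -
  let ?P = "eigenpairs TYPE('a) n" and ?V = "carrier_vec n - {0\<^sub>v n} :: 'a vec set"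
  have fibre: "card {x \<in> ?P. snd x = v} = CARD('a) ^ (n\<^sup>2 - n + 1) - 1" if "v \<in> ?V" for v
  proof -
    let ?E = "{M \<in> carrier_mat n n. \<exists>k. eigenvector M v k}"
    have v: "v \<in> carrier_vec n" "v \<noteq> 0\<^sub>v n" using that by auto
    then have "0\<^sub>m n n *\<^sub>v v = 0 \<cdot>\<^sub>v v" by (intro eq_vecI) auto
    then have "0\<^sub>m n n \<in> ?E" using v by (auto simp: eigenvector_def)
    moreover have "{x \<in> ?P. snd x = v} = (?E - {0\<^sub>m n n}) \<times> {v}"
      by (auto simp: eigenpairs_iff)
    ultimately show ?thesis
      using card_mats_with_given_eigenvector[OF v] by (simp add: card_cartesian_product)
  qed
  have "card ?P = (\<Sum>x \<in> ?P. 1)" by simp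
  also have "\<dots> = (\<Sum>v \<in> ?V. \<Sum>x \<in> {x \<in> ?P. snd x = v}. 1)"
    by (intro sum.group[symmetric]) (auto simp: finite_eigenpairs dest: eigenpairsD)
  also have "\<dots> = (\<Sum>v \<in> ?V. CARD('a) ^ (n\<^sup>2 - n + 1) - 1)"
    using fibre by (intro sum.cong) auto
  finally show ?thesis by (simp add: card_carrier_vec)
qed

lemma sig_incidence_eq_image:
  "sig_incidence TYPE('a :: field) n = map_prod (mat_line n) (vec_line n) ` eigenpairs TYPE('a) n"
proof -
  have "{(f M, g v) | M v. Q M v} = map_prod f g ` {(M, v). Q M v}"
    for f :: "'a mat \<Rightarrow> 'a mat set" and g :: "'a vec \<Rightarrow> 'a vec set" and Q
    by force
  then show ?thesis unfolding sig_incidence_def eigenpairs_def .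
qed

lemma smult_eigenpair:
  assumes "(M, v) \<in> eigenpairs TYPE('a :: field) n" "c \<noteq> 0" "d \<noteq> 0"
  shows "(c \<cdot>\<^sub>m M, d \<cdot>\<^sub>v v) \<in> eigenpairs TYPE('a) n"
proof -
  note Mv = eigenpairsD[OF assms(1)]
  obtain k where "eigenvector M v k" using assms(1) by (auto simp: eigenpairs_iff)
  moreover have "c \<cdot>\<^sub>m M \<noteq> 0\<^sub>m n n"
  proof
    assume "c \<cdot>\<^sub>m M = 0\<^sub>m n n"
    then have "c \<cdot>\<^sub>m M = 0 \<cdot>\<^sub>m M" using Mv(1) by (auto intro!: eq_matI)
    then show False using smult_mat_cancel[OF Mv(1,2)] assms(2) by blast
  qed
  ultimately show ?thesis
    using eigenvector_smult[OF Mv(1) _ assms(2,3)] Mv(1) by (auto simp: eigenpairs_iff)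
qed

lemma mat_line_smult:
  assumes "M \<in> carrier_mat n n" "c \<noteq> 0"
  shows "mat_line n (c \<cdot>\<^sub>m M) = mat_line n (M :: 'a :: field mat)"
proof -
  have "d \<cdot>\<^sub>m M = (d / c) \<cdot>\<^sub>m (c \<cdot>\<^sub>m M)" "d \<cdot>\<^sub>m (c \<cdot>\<^sub>m M) = (d * c) \<cdot>\<^sub>m M" for d
    using assms by (auto intro!: eq_matI)
  then have "{d \<cdot>\<^sub>m (c \<cdot>\<^sub>m M) | d. True} = {d \<cdot>\<^sub>m M | d. True}" by blast
  then show ?thesis using assms by (simp only: mat_line_eq smult_carrier_mat)
qed

lemma vec_line_smult:
  assumes "v \<in> carrier_vec n" "c \<noteq> 0"
  shows "vec_line n (c \<cdot>\<^sub>v v) = vec_line n (v :: 'a :: field vec)"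
proof -
  have "d \<cdot>\<^sub>v v = (d / c) \<cdot>\<^sub>v (c \<cdot>\<^sub>v v)" "d \<cdot>\<^sub>v (c \<cdot>\<^sub>v v) = (d * c) \<cdot>\<^sub>v v" for d
    using assms by (auto intro!: eq_vecI)
  then have "{d \<cdot>\<^sub>v (c \<cdot>\<^sub>v v) | d. True} = {d \<cdot>\<^sub>v v | d. True}" by blast
  then show ?thesis using assms by (simp only: vec_line_eq smult_carrier_vec)
qed

text \<open>A line has \<open>q - 1\<close> generators, the nonzero multiples of any one of them, and incidence does
  not depend on which generators are chosen.\<close>

lemma card_eigenpair_fibre:
  assumes "(M, v) \<in> eigenpairs TYPE('a :: {finite, field}) n"
  shows "card {x \<in> eigenpairs TYPE('a) n.
      map_prod (mat_line n) (vec_line n) x = (mat_line n M, vec_line n v)} = (CARD('a) - 1)\<^sup>2"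
    (is "card ?F = _")
proof -
  note Mv = eigenpairsD[OF assms]
  let ?U = "UNIV - {0 :: 'a}" and ?s = "\<lambda>(c, d). (c \<cdot>\<^sub>m M, d \<cdot>\<^sub>v v)"
  have "?F = ?s ` (?U \<times> ?U)"
  proof (intro equalityI subsetI)
    fix x assume "x \<in> ?F"
    then obtain N w where x: "x = (N, w)" "(N, w) \<in> eigenpairs TYPE('a) n"
      and eq: "mat_line n M = mat_line n N" "vec_line n v = vec_line n w"
      by (cases x) auto
    note Nw = eigenpairsD[OF x(2)]
    obtain c where "c \<noteq> 0" "N = c \<cdot>\<^sub>m M" using line_eq_imp_mat[OF Mv(1) Nw(1,2) eq(1)] .
    moreover obtain d where "d \<noteq> 0" "w = d \<cdot>\<^sub>v v" using line_eq_imp_vec[OF Mv(3) Nw(3,4) eq(2)] .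
    ultimately show "x \<in> ?s ` (?U \<times> ?U)" using x(1) by auto
  next
    fix x assume "x \<in> ?s ` (?U \<times> ?U)"
    then show "x \<in> ?F"
      using smult_eigenpair[OF assms] Mv by (auto simp: mat_line_smult vec_line_smult)
  qed
  moreover have "inj_on ?s (?U \<times> ?U)"
    using smult_mat_cancel[OF Mv(1,2)] smult_vec_cancel[OF Mv(3,4)] by (fastforce simp: inj_on_def)
  ultimately show ?thesis
    by (simp add: card_image card_cartesian_product power2_eq_square)
qed

lemma card_sig_incidence:
  "(CARD('a) - 1)\<^sup>2 * card (sig_incidence TYPE('a :: {finite, field}) n)
    = (CARD('a) ^ n - 1) * (CARD('a) ^ (n\<^sup>2 - n + 1) - 1)"
proof -
  let ?P = "eigenpairs TYPE('a) n" and ?p = "map_prod (mat_line n) (vec_line n)"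
  have "card ?P = (\<Sum>x \<in> ?P. 1)" by simp
  also have "\<dots> = (\<Sum>y \<in> ?p ` ?P. \<Sum>x \<in> {x \<in> ?P. ?p x = y}. 1)"
    by (intro sum.group[symmetric]) (auto simp: finite_eigenpairs)
  also have "\<dots> = (\<Sum>y \<in> ?p ` ?P. (CARD('a) - 1)\<^sup>2)"
  proof (rule sum.cong)
    fix y assume "y \<in> ?p ` ?P"
    then obtain M v where "(M, v) \<in> ?P" "y = (mat_line n M, vec_line n v)" by auto
    then show "(\<Sum>x \<in> {x \<in> ?P. ?p x = y}. 1) = (CARD('a) - 1)\<^sup>2"
      using card_eigenpair_fibre by simp
  qed simp
  finally show ?thesis by (simp add: card_eigenpairs sig_incidence_eq_image mult.commute)
qed

section \<open>The incidence graph as a simple graph\<close>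

lemma tail_SIG [simp]: "tail (SIG ty n) = fst" and head_SIG [simp]: "head (SIG ty n) = snd"
  by (simp_all add: SIG_def)

lemma arcs_SIG:
  "arcs (SIG ty n) = (\<lambda>(L, l). (Inl L, Inr l)) ` sig_incidence ty n
    \<union> (\<lambda>(L, l). (Inr l, Inl L)) ` sig_incidence ty n"
  by (auto simp: SIG_def)

lemma arc_SIG_iff:
  "(Inl L, y) \<in> arcs (SIG ty n) \<longleftrightarrow> (\<exists>l. y = Inr l \<and> (L, l) \<in> sig_incidence ty n)"
  "(Inr l, y) \<in> arcs (SIG ty n) \<longleftrightarrow> (\<exists>L. y = Inl L \<and> (L, l) \<in> sig_incidence ty n)"
  by (auto simp: SIG_def)

text \<open>The two opposite arcs of an incidence have the same set of end points, and the tags of the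
  disjoint union allow the incidence to be recovered from that set.\<close>

lemma card_uedges_SIG:
  "card (uedges (SIG TYPE('a :: field) n)) = card (sig_incidence TYPE('a) n)"
proof -
  have "uedges (SIG TYPE('a) n) = (\<lambda>(L, l). {Inl L, Inr l}) ` sig_incidence TYPE('a) n"
    by (simp add: uedges_def arcs_SIG image_Un image_image case_prod_beta insert_commute)
  moreover have "inj_on (\<lambda>(L, l). {Inl L, Inr l}) (sig_incidence TYPE('a) n)"
    by (auto simp: inj_on_def doubleton_eq_iff)
  ultimately show ?thesis by (simp add: card_image)
qed

lemma graph_SIG: "graph (SIG TYPE('a :: {finite, field}) n)"
proof -
  interpret wf_digraph "SIG TYPE('a) n" by (rule wf_digraph_SIG)
  have "finite (verts (SIG TYPE('a) n))"
    by (auto simp: SIG_def mat_points_def vec_points_def mats_with_eigenvector_def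
        intro!: finite_imageI intro: finite_subset[OF _ finite_carrier_mat[of n n]])
  moreover have "finite (sig_incidence TYPE('a) n)"
    by (simp add: sig_incidence_eq_image finite_eigenpairs)
  then have "finite (arcs (SIG TYPE('a) n))" by (simp add: arcs_SIG)
  ultimately interpret fin_digraph "SIG TYPE('a) n" by unfold_locales
  interpret digraph "SIG TYPE('a) n"
    by unfold_locales (auto simp: SIG_def arc_to_ends_def)
  have "arcs_ends (SIG TYPE('a) n) = arcs (SIG TYPE('a) n)"
    by (simp add: arcs_ends_conv)
  moreover have "sym (arcs (SIG TYPE('a) n))"
    by (auto simp: sym_def SIG_def)
  ultimately show ?thesis
    by (intro graphI) (simp add: symmetric_def)
qed


section \<open>Connectedness and diameter\<close>

lemma (in wf_digraph) graph_dist_eq: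
  "graph_dist G u v = (INF p \<in> {p. awalk u p v}. ereal (real (length p)))"
proof -
  have "awalk_cost (\<lambda>_. 1) p = real (length p)" for p
    by (induction p) auto
  then show ?thesis by (simp add: graph_dist_def \<mu>_def)
qed

lemma one_mat_in_mats_with_eigenvector:
  assumes "n > 0"
  shows "1\<^sub>m n \<in> mats_with_eigenvector TYPE('a :: field) n"
proof -
  have "eigenvector (1\<^sub>m n) (unit_vec n 0 :: 'a vec) 1"
    using assms by (auto simp: eigenvector_def)
  moreover have "(1\<^sub>m n :: 'a mat) $$ (0, 0) \<noteq> 0\<^sub>m n n $$ (0, 0)"
    using assms by simp
  ultimately show ?thesis by (auto simp: mats_with_eigenvector_def)
qed

lemma one_mat_incident:
  assumes "n > 0" "l \<in> vec_points TYPE('a :: field) n"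
  shows "(mat_line n (1\<^sub>m n), l) \<in> sig_incidence TYPE('a) n"
proof -
  obtain v where v: "v \<in> carrier_vec n" "v \<noteq> 0\<^sub>v n" "l = vec_line n v"
    using assms(2) by (auto simp: vec_points_def)
  then have "eigenvector (1\<^sub>m n) v 1" by (auto simp: eigenvector_def)
  then show ?thesis
    using sig_incidence_iff[OF one_mat_in_mats_with_eigenvector[OF assms(1)] v(1,2)] v(3) by blast
qed

lemma mat_point_incident:
  assumes "L \<in> mat_points TYPE('a :: field) n"
  obtains l where "l \<in> vec_points TYPE('a) n" "(L, l) \<in> sig_incidence TYPE('a) n"
proof -
  obtain M where "M \<in> mats_with_eigenvector TYPE('a) n" "L = mat_line n M"
    using assms by (auto simp: mat_points_def)
  moreover from this obtain v k where "eigenvector M v k"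
    by (auto simp: mats_with_eigenvector_def)
  ultimately show ?thesis
    by (intro that[of "vec_line n v"])
      (auto simp: vec_points_def sig_incidence_def eigenvector_def mats_with_eigenvector_def)
qed

text \<open>A point is adjacent to the line of the identity; a matrix vertex reaches it through the point
  of one of its eigenvectors. Both directions are stated, so that the walks can be concatenated.\<close>

lemma walks_via_one_mat:
  assumes "n > 0" "u \<in> verts (SIG TYPE('a :: field) n)"
  shows "\<exists>p. pre_digraph.awalk (SIG TYPE('a) n) u p (Inl (mat_line n (1\<^sub>m n))) \<and> length p \<le> 2"
    and "\<exists>p. pre_digraph.awalk (SIG TYPE('a) n) (Inl (mat_line n (1\<^sub>m n))) p u \<and> length p \<le> 2"
proof -
  let ?G = "SIG TYPE('a) n" and ?c = "mat_line n (1\<^sub>m n :: 'a mat)"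
  interpret wf_digraph ?G by (rule wf_digraph_SIG)
  have "?c \<in> mat_points TYPE('a) n"
    using one_mat_in_mats_with_eigenvector[OF assms(1), where 'a = 'a] by (simp add: mat_points_def)
  then have c: "Inl ?c \<in> verts ?G" by (auto simp: SIG_def)
  have "(\<exists>p. awalk u p (Inl ?c) \<and> length p \<le> 2) \<and> (\<exists>p. awalk (Inl ?c) p u \<and> length p \<le> 2)"
  proof (cases u)
    case (Inl L)
    then obtain l where l: "l \<in> vec_points TYPE('a) n" "(L, l) \<in> sig_incidence TYPE('a) n"
      using assms(2) mat_point_incident by (auto simp: SIG_def)
    note c1 = one_mat_incident[OF assms(1) l(1)]
    have "awalk u [(Inl L, Inr l), (Inr l, Inl ?c)] (Inl ?c)"
      "awalk (Inl ?c) [(Inl ?c, Inr l), (Inr l, Inl L)] u"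
      using assms(2) c l c1 Inl by (auto simp: awalk_def arc_SIG_iff)
    then show ?thesis by (intro conjI exI) (assumption | simp)+
  next
    case (Inr l)
    then have "(?c, l) \<in> sig_incidence TYPE('a) n"
      using assms one_mat_incident by (auto simp: SIG_def)
    then have "awalk u [(Inr l, Inl ?c)] (Inl ?c)" "awalk (Inl ?c) [(Inl ?c, Inr l)] u"
      using assms(2) c Inr by (auto simp: awalk_def arc_SIG_iff)
    then show ?thesis by (intro conjI exI) (assumption | simp)+
  qed
  then show "\<exists>p. awalk u p (Inl ?c) \<and> length p \<le> 2" "\<exists>p. awalk (Inl ?c) p u \<and> length p \<le> 2"
    by blast+
qed

lemma short_walk_SIG:
  assumes "n > 0" "u \<in> verts (SIG TYPE('a :: field) n)" "v \<in> verts (SIG TYPE('a) n)"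
  shows "\<exists>p. pre_digraph.awalk (SIG TYPE('a) n) u p v \<and> length p \<le> 4"
proof -
  interpret wf_digraph "SIG TYPE('a) n" by (rule wf_digraph_SIG)
  obtain p r where "awalk u p (Inl (mat_line n (1\<^sub>m n)))" "length p \<le> 2"
    "awalk (Inl (mat_line n (1\<^sub>m n))) r v" "length r \<le> 2"
    using walks_via_one_mat(1)[OF assms(1,2)] walks_via_one_mat(2)[OF assms(1,3)] by blast
  then have "awalk u (p @ r) v" "length (p @ r) \<le> 4"
    by (auto intro: awalk_appendI)
  then show ?thesis by blast
qed

lemma connected_SIG:
  assumes "n > 0"
  shows "Digraph_Component.connected (SIG TYPE('a :: field) n)"
proof -
  interpret wf_digraph "SIG TYPE('a) n" by (rule wf_digraph_SIG)
  have "Inl (mat_line n (1\<^sub>m n :: 'a mat)) \<in> verts (SIG TYPE('a) n)"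
    using one_mat_in_mats_with_eigenvector[OF assms, where 'a = 'a]
    by (auto simp: SIG_def mat_points_def)
  moreover have "u \<rightarrow>\<^sup>*\<^bsub>SIG TYPE('a) n\<^esub> v" if "u \<in> verts (SIG TYPE('a) n)" "v \<in> verts (SIG TYPE('a) n)" for u v
    using short_walk_SIG[OF assms that] by (auto simp: reachable_awalk)
  ultimately show ?thesis
    unfolding Digraph_Component.connected_def
    by (intro strongly_connectedI reachable_mk_symmetricI) auto
qed

text \<open>The nilpotent Jordan block: it sends the \<open>i\<close>-th unit vector to its predecessor, and the
  first one to 0. Its transpose shifts in the other direction.\<close>

definition shift_mat :: "nat \<Rightarrow> 'a :: field mat" where
  "shift_mat n = mat n n (\<lambda>(i, j). if j = Suc i then 1 else 0)"

lemma shift_mat_carrier [simp]: "shift_mat n \<in> carrier_mat n n"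
  by (simp add: shift_mat_def)

lemma shift_mat_mult_vec:
  assumes "v \<in> carrier_vec n"
  shows "shift_mat n *\<^sub>v v = vec n (\<lambda>i. if Suc i < n then v $ Suc i else 0)"
proof (rule eq_vecI)
  fix i assume "i < dim_vec (vec n (\<lambda>i. if Suc i < n then v $ Suc i else 0))"
  then have i: "i < n" by simp
  have "(shift_mat n *\<^sub>v v) $ i = (\<Sum>j = 0..<n. (if j = Suc i then 1 else 0) * v $ j)"
    using i assms by (simp add: shift_mat_def scalar_prod_def)
  also have "\<dots> = (\<Sum>j = 0..<n. if j = Suc i then v $ j else 0)"
    by (rule sum.cong) auto
  finally show "(shift_mat n *\<^sub>v v) $ i = vec n (\<lambda>i. if Suc i < n then v $ Suc i else 0) $ i"
    using i by simp
qed (simp add: shift_mat_def)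

lemma transpose_shift_mat_mult_vec:
  assumes "v \<in> carrier_vec n"
  shows "transpose_mat (shift_mat n) *\<^sub>v v = vec n (\<lambda>i. if i = 0 then 0 else v $ (i - 1))"
proof (rule eq_vecI)
  fix i assume "i < dim_vec (vec n (\<lambda>i. if i = 0 then 0 else v $ (i - 1)))"
  then have i: "i < n" by simp
  have "(transpose_mat (shift_mat n) *\<^sub>v v) $ i = (\<Sum>j = 0..<n. (if i = Suc j then 1 else 0) * v $ j)"
    using i assms by (simp add: shift_mat_def scalar_prod_def)
  also have "\<dots> = (\<Sum>j = 0..<n. if j = i - 1 then (if i = 0 then 0 else v $ j) else 0)"
    by (rule sum.cong) auto
  finally show "(transpose_mat (shift_mat n) *\<^sub>v v) $ i = vec n (\<lambda>i. if i = 0 then 0 else v $ (i - 1)) $ i"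
    using i by auto
qed (simp add: shift_mat_def)

text \<open>With eigenvalues \<open>k\<close> and \<open>l\<close>, the entries of a common eigenvector satisfy
  \<open>v (i + 1) = k * v i\<close> and \<open>v i = l * v (i + 1)\<close>, while the first row of the transpose, which is
  zero, gives \<open>l * v 0 = 0\<close>. Hence \<open>v 0 = l * v 1 = k * (l * v 0) = 0\<close>, and all entries
  vanish. In dimension 1 both matrices are zero and every vector is a common eigenvector, whence
  \<open>n \<ge> 2\<close>.\<close>

lemma no_common_eigenvector_shift_mat:
  assumes "n \<ge> 2" "eigenvector (shift_mat n) v k"
  shows "\<not> eigenvector (transpose_mat (shift_mat n)) v (l :: 'a :: field)"
proof
  assume *: "eigenvector (transpose_mat (shift_mat n)) v l"
  have v: "v \<in> carrier_vec n" "v \<noteq> 0\<^sub>v n"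
    using assms(2) by (auto simp: eigenvector_def shift_mat_def)
  have S: "shift_mat n *\<^sub>v v = k \<cdot>\<^sub>v v" and T: "transpose_mat (shift_mat n) *\<^sub>v v = l \<cdot>\<^sub>v v"
    using assms(2) * by (auto simp: eigenvector_def)
  have k: "k * v $ i = (if Suc i < n then v $ Suc i else 0)" if "i < n" for i
    using arg_cong[OF S, of "\<lambda>w. w $ i"] v(1) that by (simp add: shift_mat_mult_vec)
  have l: "l * v $ i = (if i = 0 then 0 else v $ (i - 1))" if "i < n" for i
    using arg_cong[OF T, of "\<lambda>w. w $ i"] v(1) that by (simp add: transpose_shift_mat_mult_vec)
  have "v $ i = 0" if "i < n" for i
    using that
  proof (induction i)
    case 0
    have "v $ 0 = l * v $ 1" using l[of 1] assms(1) by simp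
    also have "\<dots> = k * (l * v $ 0)" using k[of 0] assms(1) by (auto simp: mult_ac)
    also have "\<dots> = 0" using l[of 0] assms(1) by simp
    finally show ?case .
  next
    case (Suc i)
    then show ?case using k[of i] by simp
  qed
  then show False using nonzero_vec_entry[OF v] by blast
qed

lemma shift_mats_in_mats_with_eigenvector:
  assumes "n \<ge> 2"
  shows "shift_mat n \<in> mats_with_eigenvector TYPE('a :: field) n"
    and "transpose_mat (shift_mat n) \<in> mats_with_eigenvector TYPE('a) n"
proof -
  have "shift_mat n *\<^sub>v (unit_vec n 0 :: 'a vec) = 0 \<cdot>\<^sub>v unit_vec n 0"
    by (subst shift_mat_mult_vec) (auto intro!: eq_vecI)
  then have "eigenvector (shift_mat n) (unit_vec n 0 :: 'a vec) 0"
    using assms by (auto simp: eigenvector_def shift_mat_def)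
  moreover have "shift_mat n $$ (0, 1) \<noteq> (0\<^sub>m n n :: 'a mat) $$ (0, 1)"
    using assms by (simp add: shift_mat_def)
  ultimately show "shift_mat n \<in> mats_with_eigenvector TYPE('a) n"
    by (auto simp: mats_with_eigenvector_def)
  have "transpose_mat (shift_mat n) *\<^sub>v (unit_vec n (n - 1) :: 'a vec) = 0 \<cdot>\<^sub>v unit_vec n (n - 1)"
    by (subst transpose_shift_mat_mult_vec) (auto intro!: eq_vecI)
  then have "eigenvector (transpose_mat (shift_mat n)) (unit_vec n (n - 1) :: 'a vec) 0"
    using assms by (auto simp: eigenvector_def shift_mat_def)
  moreover have "transpose_mat (shift_mat n) $$ (1, 0) \<noteq> (0\<^sub>m n n :: 'a mat) $$ (1, 0)"
    using assms by (simp add: shift_mat_def)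
  ultimately show "transpose_mat (shift_mat n) \<in> mats_with_eigenvector TYPE('a) n"
    by (auto simp: mats_with_eigenvector_def)
qed

text \<open>A walk between two matrix vertices alternates between the two sides, so its length is even;
  length 2 would produce a common neighbour, hence a common eigenvector, and length 0 likewise
  because every matrix vertex has a neighbour.\<close>

lemma long_walk_SIG:
  assumes MN: "M \<in> mats_with_eigenvector TYPE('a :: field) n" "N \<in> mats_with_eigenvector TYPE('a) n"
    and no: "\<And>v k l. eigenvector M v k \<Longrightarrow> \<not> eigenvector N v l"
    and p: "pre_digraph.awalk (SIG TYPE('a) n) (Inl (mat_line n M)) p (Inl (mat_line n N))"
  shows "length p \<ge> 4"
proof (rule ccontr)
  assume short: "\<not> ?thesis"
  interpret wf_digraph "SIG TYPE('a) n" by (rule wf_digraph_SIG)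
  have common: False
    if Ll: "(mat_line n M, l) \<in> sig_incidence TYPE('a) n" "(mat_line n N, l) \<in> sig_incidence TYPE('a) n" for l
  proof -
    obtain v where "v \<in> carrier_vec n" "v \<noteq> 0\<^sub>v n" "l = vec_line n v"
      using Ll(1) by (auto simp: sig_incidence_eq_image dest: eigenpairsD)
    then show False using Ll MN no by (auto simp: sig_incidence_iff)
  qed
  have step:
    "awalk (Inl L) (a # r) y \<longleftrightarrow>
      (\<exists>l. a = (Inl L, Inr l) \<and> (L, l) \<in> sig_incidence TYPE('a) n \<and> awalk (Inr l) r y)"
    "awalk (Inr l) (a # r) y \<longleftrightarrow>
      (\<exists>L. a = (Inr l, Inl L) \<and> (L, l) \<in> sig_incidence TYPE('a) n \<and> awalk (Inl L) r y)"
    for L l a r y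
    by (cases a; auto simp: awalk_Cons_iff arc_SIG_iff)+
  have neq: "mat_line n M \<noteq> mat_line n N"
    using MN common by (metis imageI mat_point_incident mat_points_def)
  consider "p = []" | a where "p = [a]" | a b where "p = [a, b]" | a b c where "p = [a, b, c]"
    using short by (auto simp: not_le numeral_eq_Suc less_Suc_eq length_Suc_conv)
  then show False
    using p common neq by cases (auto simp: step awalk_Nil_iff)
qed

lemma diam_SIG:
  assumes "n \<ge> 2"
  shows "diam (SIG TYPE('a :: field) n) = 4"
  unfolding diam_def
proof (rule antisym)
  let ?G = "SIG TYPE('a) n"
  interpret wf_digraph ?G by (rule wf_digraph_SIG)
  show "(SUP (u, v) \<in> verts ?G \<times> verts ?G. graph_dist ?G u v) \<le> 4"
  proof (rule SUP_least, clarify)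
    fix u v assume "u \<in> verts ?G" "v \<in> verts ?G"
    then obtain p where p: "awalk u p v" "length p \<le> 4"
      using short_walk_SIG[of n u v] assms by auto
    then have "ereal (real (length p)) \<le> 4" by simp
    with p(1) show "graph_dist ?G u v \<le> 4"
      unfolding graph_dist_eq by (intro INF_lower2[of p]) simp_all
  qed
  let ?S = "Inl (mat_line n (shift_mat n))" and ?T = "Inl (mat_line n (transpose_mat (shift_mat n)))"
  note ST = shift_mats_in_mats_with_eigenvector[OF assms]
  have "4 \<le> length p" if "awalk ?S p ?T" for p
    using long_walk_SIG[OF ST no_common_eigenvector_shift_mat[OF assms] that] .
  then have "4 \<le> ereal (real (length p))" if "awalk ?S p ?T" for p
    using that by simp
  then have "4 \<le> graph_dist ?G ?S ?T"
    unfolding graph_dist_eq by (intro INF_greatest) simp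
  moreover have "(?S, ?T) \<in> verts ?G \<times> verts ?G"
    using ST by (auto simp: SIG_def mat_points_def)
  ultimately show "4 \<le> (SUP (u, v) \<in> verts ?G \<times> verts ?G. graph_dist ?G u v)"
    by (intro SUP_upper2[of "(?S, ?T)"]) simp_all
qed

theorem theorem1p12:
  fixes n q :: nat
  assumes "n \<ge> 2"
    and "primepow q"
    and "CARD('a :: {finite, field}) = q"
  shows "graph (SIG TYPE('a) n)
    \<and> Digraph_Component.connected (SIG TYPE('a) n)
    \<and> real (card (uedges (SIG TYPE('a) n))) =
        (real q ^ n - 1) / (real q - 1)\<^sup>2 * (real q ^ (n\<^sup>2 - n + 1) - 1)
    \<and> diam (SIG TYPE('a) n) = 4"
proof (intro conjI)
  have q: "q > 1" using assms(2) by (auto dest: primepow_gt_Suc_0)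
  have "real ((q - 1)\<^sup>2 * card (sig_incidence TYPE('a) n))
      = real ((q ^ n - 1) * (q ^ (n\<^sup>2 - n + 1) - 1))"
    using card_sig_incidence[where 'a = 'a, of n] assms(3) by simp
  then have "(real q - 1)\<^sup>2 * real (card (sig_incidence TYPE('a) n))
      = (real q ^ n - 1) * (real q ^ (n\<^sup>2 - n + 1) - 1)"
    using q by (simp add: of_nat_diff del: power_Suc)
  then show "real (card (uedges (SIG TYPE('a) n))) =
      (real q ^ n - 1) / (real q - 1)\<^sup>2 * (real q ^ (n\<^sup>2 - n + 1) - 1)"
    using q by (simp add: card_uedges_SIG field_simps del: power_Suc)
  show "graph (SIG TYPE('a) n)" by (rule graph_SIG)
  show "Digraph_Component.connected (SIG TYPE('a) n)"
    using assms(1) by (intro connected_SIG) simp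
  show "diam (SIG TYPE('a) n) = 4"
    using assms(1) by (rule diam_SIG)
qed

end
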